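(* For any $\alpha\in\mathbb{R}\setminus\mathbb{Q}$ and any increasing function $f:\mathbb{N}\to(0,+\infty)$ satisfying $f(N)=o(N)$ as $N\to\infty$, there exist continuum many $\gamma\in\mathbb{R}$ satisfying $\|n\alpha-\gamma\|>0$ for all $n\in\mathbb{N}$ and such that $$\limsup_{N\to\infty}\ f(N)^{-1}\left(S_N(\alpha,\gamma)-\max_{1\le n\le N}\frac{1}{n\|n\alpha-\gamma\|}\right)=\infty.$$
   Context: $\|x\|$ denotes the distance from $x\in\mathbb{R}$ to the nearest integer. $S_N(\alpha,\gamma):=\sum_{n=1}^N\frac{1}{n\|n\alpha-\gamma\|}$. *)

theory Defs
  imports "HOL-Analysis.Analysis" "HOL-Library.Equipollence" "HOL-Library.Landau_Symbols"
begin

definition dist_nearest_int :: "real \<Rightarrow> real"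
  where "dist_nearest_int x = infdist x \<int>"

(* If some denominator dist_nearest_int (n * \<alpha> - \<gamma>) vanishes, the corresponding term
   is 0 by the convention x / 0 = 0; the sum is only meant for \<gamma> avoiding this. *)
definition recip_sum :: "nat \<Rightarrow> real \<Rightarrow> real \<Rightarrow> real"
  where "recip_sum N \<alpha> \<gamma> =
    (\<Sum>n = 1..N. 1 / (real n * dist_nearest_int (real n * \<alpha> - \<gamma>)))"

end

theory Submission
  imports Defs
begin

text \<open>
  Subtracting the largest term of \<open>S\<^sub>N(\<alpha>, \<gamma>)\<close> leaves a large remainder as soon as two different terms
  are large: at least one of them survives (\<open>le_sum_minus_Max\<close>). So it is enough to find \<open>\<gamma>\<close>, avoiding all
  points \<open>n\<alpha> + p\<close> with \<open>p\<close> an integer, such that for every \<open>K\<close> some \<open>N \<ge> K\<close> admits two indices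
  \<open>m \<noteq> n\<close> in \<open>{1..N}\<close> whose terms both exceed \<open>K f(N)\<close>.

  Such a pair arises as follows. Fix \<open>m\<close>, let \<open>q\<close> be a large denominator with \<open>\<parallel>q\<alpha>\<parallel> < 1/q\<close>, and put
  \<open>n = N = m + q\<close>. For \<open>\<gamma>\<close> extremely close to \<open>n\<alpha>\<close> modulo 1 the term of index \<open>n\<close> is as large as desired,
  while \<open>\<parallel>m\<alpha> - \<gamma>\<parallel>\<close> is about \<open>\<parallel>q\<alpha>\<parallel>\<close>, so the term of index \<open>m\<close> is at least about \<open>q/m\<close>. As \<open>m\<close> is fixed and
  \<open>f(m + q) = o(q)\<close>, this exceeds \<open>K f(N)\<close> once \<open>q\<close> is large.

  For given \<open>K\<close> the requirement on \<open>\<gamma>\<close> is open, and it is dense because the multiples \<open>m\<alpha>\<close> are dense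
  modulo 1 and \<open>\<parallel>q\<alpha>\<parallel>\<close> is small (\<open>dense_two_large_terms\<close>). Avoiding the countably many points \<open>n\<alpha> + p\<close>
  amounts to countably many further dense open conditions. Hence the good shifts contain a dense countable
  intersection of open sets. Such a set is completely metrizable and, by the Baire category theorem, nonempty without
  isolated points, so it has at least the power of the continuum (\<open>continuum_lepoll_dense_Inter\<close>).
\<close>

section \<open>Dense countable intersections of open sets have the power of the continuum\<close>

text \<open>
  The intersection is completely metrizable, being a countable intersection of open sets in a complete space.
  Deleting a point is one more dense open condition, so the Baire category theorem still gives density afterwards;
  hence no point is isolated, and a nonempty perfect completely metrizable space contains a copy of the Cantor set.
\<close>
lemma continuum_lepoll_dense_Inter:
  fixes \<U> :: "'a::euclidean_space set set"
  assumes "countable \<U>" and opn: "\<And>U. U \<in> \<U> \<Longrightarrow> open U" and dense: "\<And>U. U \<in> \<U> \<Longrightarrow> closure U = UNIV"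
  shows "(UNIV :: real set) \<lesssim> \<Inter>\<U>"
proof -
  let ?G = "\<Inter>\<U>"
  have dense_minus: "closure (?G - {x}) = UNIV" for x
  proof -
    have "UNIV \<subseteq> closure (\<Inter>(insert (- {x}) \<U>))"
      by (rule Baire) (use assms in \<open>auto simp: closure_complement open_Compl\<close>)
    moreover have "\<Inter>(insert (- {x}) \<U>) = ?G - {x}"
      by blast
    ultimately show ?thesis
      by auto
  qed
  have "(countable intersection_of openin euclidean) ?G"
    using assms(1) opn unfolding intersection_of_def by auto
  then have "completely_metrizable_space (top_of_set ?G)"
    by (intro completely_metrizable_space_gdelta_in_alt completely_metrizable_space_euclidean)
  moreover have "top_of_set ?G derived_set_of ?G = ?G"
  proof -
    have "x \<in> euclidean derived_set_of ?G" for x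
      unfolding in_derived_set_of
    proof (intro conjI allI impI)
      fix T assume T: "x \<in> T \<and> openin euclidean T"
      then have "(?G - {x}) \<inter> T \<noteq> {}"
        using dense_minus[of x] open_Int_closure_eq_empty[of T "?G - {x}"] by auto
      then show "\<exists>y\<noteq>x. y \<in> ?G \<and> y \<in> T"
        by blast
    qed simp
    then show ?thesis
      by (auto simp: derived_set_of_subtopology)
  qed
  moreover have "?G \<noteq> {}"
    using dense_minus[of 0] by auto
  ultimately show ?thesis
    using lepoll_perfect_set[of "top_of_set ?G" ?G] by blast
qed

section \<open>Distance to the nearest integer and Diophantine approximation\<close>

lemma dist_nearest_int_nonneg: "0 \<le> dist_nearest_int x"
  by (simp add: dist_nearest_int_def infdist_nonneg)

lemma dist_nearest_int_le: "dist_nearest_int x \<le> \<bar>x - of_int p\<bar>"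
  unfolding dist_nearest_int_def by (metis infdist_le Ints_of_int dist_real_def)

lemma dist_nearest_int_pos_iff: "0 < dist_nearest_int x \<longleftrightarrow> x \<notin> \<int>"
proof -
  have "x \<in> \<int> \<longleftrightarrow> infdist x \<int> = 0"
    by (rule in_closed_iff_infdist_zero) (auto simp: closed_Ints)
  then show ?thesis
    using dist_nearest_int_nonneg[of x] by (auto simp: dist_nearest_int_def)
qed

lemma continuous_on_dist_nearest_int [continuous_intros]:
  "continuous_on S g \<Longrightarrow> continuous_on S (\<lambda>x. dist_nearest_int (g x))"
  unfolding dist_nearest_int_def by (rule continuous_on_infdist)

text \<open>
  An irrational number has infinitely many approximations \<open>h/k\<close> with error below \<open>1/k\<^sup>2\<close>, so their denominators
  are unbounded. The lemma serves to bring \<open>m\<alpha>\<close> and \<open>(m + q)\<alpha>\<close> within \<open>1/q\<close> of each other modulo 1.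
\<close>
lemma irrational_approx_infinitely_often:
  fixes \<alpha> :: real
  assumes "\<alpha> \<notin> \<rat>"
  obtains q :: nat and p :: int where "q \<ge> Q" "q > 0" "\<bar>real q * \<alpha> - of_int p\<bar> < 1 / real q"
proof -
  have "infinite (approx_set \<alpha>)"
    using assms rational_iff_finite_approx_set by blast
  then obtain h k where hk: "(h, k) \<in> approx_set \<alpha>" "k > int Q"
    using infinite_approx_set by blast
  then have "k > 0" "\<bar>\<alpha> - of_int h / of_int k\<bar> < 1 / (of_int k)\<^sup>2"
    by (auto simp: approx_set_def)
  then have "of_int k * \<bar>\<alpha> - of_int h / of_int k\<bar> < of_int k * (1 / (of_int k)\<^sup>2)"
    by (intro mult_strict_left_mono) auto
  also have "\<dots> = 1 / of_int k"
    by (simp add: power2_eq_square)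
  also have "of_int k * \<bar>\<alpha> - of_int h / of_int k\<bar> = \<bar>of_int k * (\<alpha> - of_int h / of_int k)\<bar>"
    using \<open>k > 0\<close> by (simp add: abs_mult)
  also have "of_int k * (\<alpha> - of_int h / of_int k) = of_int k * \<alpha> - of_int h"
    using \<open>k > 0\<close> by (simp add: field_simps)
  finally have *: "\<bar>of_int k * \<alpha> - of_int h\<bar> < 1 / of_int k" .
  show thesis
    by (rule that[of "nat k" h]) (use hk \<open>k > 0\<close> * in auto)
qed

section \<open>Shifts with two large terms\<close>

text \<open>
  The two inequalities say that the terms of index \<open>m\<close> and \<open>n\<close> exceed \<open>K f(N)\<close>, with the denominators
  cleared. In this form they are open conditions on \<open>\<gamma>\<close>, and each of them holds where its distance vanishes, that
  is, where the quotient should be infinite but is 0 by convention. Thus the points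
  \<open>n\<alpha> + p\<close> themselves may be used to prove density.
\<close>
definition two_large_terms :: "real \<Rightarrow> (nat \<Rightarrow> real) \<Rightarrow> nat \<Rightarrow> real set"
  where "two_large_terms \<alpha> f K =
    (\<Union>N\<in>{K..}. \<Union>m\<in>{1..N}. \<Union>n\<in>{1..N} - {m}.
       {\<gamma>. real m * dist_nearest_int (real m * \<alpha> - \<gamma>) * (real K * f N) < 1 \<and>
           real n * dist_nearest_int (real n * \<alpha> - \<gamma>) * (real K * f N) < 1})"

lemma open_two_large_terms: "open (two_large_terms \<alpha> f K)"
  unfolding two_large_terms_def
  by (intro open_UN ballI open_Collect_conj open_Collect_less continuous_intros)

text \<open>
  A point near a given \<open>x\<close> is \<open>\<gamma> = (m + q)\<alpha> - h - p\<close>, where \<open>m\<alpha> - h\<close> approximates \<open>x\<close> and then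
  \<open>q\<alpha> - p\<close> is tiny: \<open>\<gamma>\<close> has distance 0 to \<open>(m + q)\<alpha>\<close> and distance at most \<open>1/q\<close> to \<open>m\<alpha>\<close> modulo 1.
\<close>
lemma dense_two_large_terms:
  fixes \<alpha> :: real and f :: "nat \<Rightarrow> real"
  assumes irr: "\<alpha> \<notin> \<rat>" and small: "f \<in> o[at_top](\<lambda>N. real N)"
  shows "closure (two_large_terms \<alpha> f K) = UNIV"
proof -
  have "\<exists>\<gamma> \<in> two_large_terms \<alpha> f K. dist \<gamma> x < e" if "e > 0" for x e :: real
  proof -
    obtain h k where "k > 0" and hk: "\<bar>of_int k * \<alpha> - of_int h - x\<bar> < e / 2"
      using sequence_of_fractional_parts_is_dense[OF irr half_gt_zero[OF \<open>e > 0\<close>], of x] by blast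
    define m where "m = nat k"
    have m: "m \<ge> 1" "real m = of_int k"
      using \<open>k > 0\<close> by (auto simp: m_def)
    (* With N = m + q <= 2 q and f N <= c N, the product to be bounded is at most
       m * (1 / q) * K * 2 c q = 2 m K c; this c makes it smaller than 1. *)
    define c where "c = 1 / (2 * (real m * real K) + 1)"
    have "c > 0"
      by (auto simp: c_def intro!: add_nonneg_pos)
    then obtain N0 where N0: "\<And>N. N \<ge> N0 \<Longrightarrow> \<bar>f N\<bar> \<le> c * real N"
      using landau_o.smallD[OF small] by (auto simp: eventually_sequentially)
    obtain Q0 :: nat where Q0: "2 / e < real Q0"
      using reals_Archimedean2 by blast
    obtain q p where q: "q \<ge> Max {N0, Q0, m, K}" "q > 0" and qp: "\<bar>real q * \<alpha> - of_int p\<bar> < 1 / real q"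
      using irrational_approx_infinitely_often[OF irr] by blast
    define n where "n = m + q"
    define \<gamma> where "\<gamma> = real n * \<alpha> - of_int (h + p)"
    have "1 / real q < e / 2"
      using q Q0 \<open>e > 0\<close> by (simp add: field_simps) (smt (verit) of_nat_le_iff mult_left_mono)
    moreover have "\<gamma> - x = (of_int k * \<alpha> - of_int h - x) + (real q * \<alpha> - of_int p)"
      using m by (simp add: \<gamma>_def n_def algebra_simps)
    ultimately have "dist \<gamma> x < e"
      using hk qp unfolding dist_real_def by linarith
    have dn: "dist_nearest_int (real n * \<alpha> - \<gamma>) = 0"
      using dist_nearest_int_pos_iff[of "real n * \<alpha> - \<gamma>"] dist_nearest_int_nonneg[of "real n * \<alpha> - \<gamma>"]
      by (simp add: \<gamma>_def)
    have "dist_nearest_int (real m * \<alpha> - \<gamma>) \<le> \<bar>(real m * \<alpha> - \<gamma>) - of_int h\<bar>"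
      by (rule dist_nearest_int_le)
    also have "\<dots> = \<bar>real q * \<alpha> - of_int p\<bar>"
      by (simp add: \<gamma>_def n_def algebra_simps)
    finally have dm: "dist_nearest_int (real m * \<alpha> - \<gamma>) \<le> 1 / real q"
      using qp by linarith
    have fn: "\<bar>f n\<bar> \<le> c * (2 * real q)"
    proof -
      have "\<bar>f n\<bar> \<le> c * real n"
        using q by (intro N0) (simp add: n_def)
      also have "\<dots> \<le> c * (2 * real q)"
        using q \<open>c > 0\<close> by (intro mult_left_mono) (auto simp: n_def)
      finally show ?thesis .
    qed
    have "real m * dist_nearest_int (real m * \<alpha> - \<gamma>) * (real K * f n)
        \<le> real m * dist_nearest_int (real m * \<alpha> - \<gamma>) * (real K * \<bar>f n\<bar>)"
      by (intro mult_left_mono mult_nonneg_nonneg) (auto simp: dist_nearest_int_nonneg)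
    also have "\<dots> \<le> real m * (1 / real q) * (real K * (c * (2 * real q)))"
      using dm fn \<open>c > 0\<close> by (intro mult_mono mult_left_mono mult_nonneg_nonneg) (auto simp: dist_nearest_int_nonneg)
    also have "\<dots> = 2 * (real m * real K) / (2 * (real m * real K) + 1)"
      using q by (simp add: c_def)
    also have "\<dots> < 1"
      by (subst pos_divide_less_eq) (auto intro: add_nonneg_pos)
    finally have large: "real m * dist_nearest_int (real m * \<alpha> - \<gamma>) * (real K * f n) < 1" .
    have "n \<in> {K..}" "m \<in> {1..n}" "n \<in> {1..n} - {m}"
      using m q by (auto simp: n_def)
    then have "\<gamma> \<in> two_large_terms \<alpha> f K"
      unfolding two_large_terms_def using large dn
      by (intro UN_I[of n "{K..}"] UN_I[of m "{1..n}"] UN_I[of n "{1..n} - {m}"] CollectI conjI) auto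
    with \<open>dist \<gamma> x < e\<close> show ?thesis
      by blast
  qed
  then show ?thesis
    by (auto simp: closure_approachable)
qed

text \<open>
  If the maximum is attained at \<open>i\<close>, the difference is the sum over all other indices, and one of \<open>m\<close>, \<open>n\<close> is among them.
\<close>
lemma le_sum_minus_Max:
  fixes t :: "'a \<Rightarrow> real"
  assumes fin: "finite A" and nonneg: "\<And>i. i \<in> A \<Longrightarrow> 0 \<le> t i"
    and mn: "m \<in> A" "n \<in> A" "m \<noteq> n" and c: "c \<le> t m" "c \<le> t n"
  shows "c \<le> sum t A - Max (t ` A)"
proof -
  have "Max (t ` A) \<in> t ` A"
    using fin mn by (intro Max_in) auto
  then obtain i where i: "i \<in> A" "Max (t ` A) = t i"
    by auto
  obtain j where j: "j \<in> A - {i}" "c \<le> t j"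
    using mn c by (cases "i = m") auto
  have "t j \<le> sum t (A - {i})"
    using fin j(1) nonneg by (intro member_le_sum) auto
  then show ?thesis
    using j(2) i sum.remove[OF fin i(1), of t] by simp
qed

lemma limsup_eq_PInfty:
  fixes u :: "nat \<Rightarrow> real"
  assumes "\<And>K. \<exists>N\<ge>K. real K \<le> u N"
  shows "limsup (\<lambda>N. ereal (u N)) = \<infinity>"
proof -
  have "ereal (real K) \<le> limsup (\<lambda>N. ereal (u N))" for K
    unfolding limsup_INF_SUP
  proof (rule INF_greatest)
    fix n
    obtain N where "N \<ge> max K n" "real (max K n) \<le> u N"
      using assms by blast
    then show "ereal (real K) \<le> (SUP m\<in>{n..}. ereal (u m))"
      by (intro SUP_upper2[of N]) auto
  qed
  then show ?thesis
    by (metis ereal_top le_cases real_arch_simple ereal_less_eq(3) order_trans)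
qed

section \<open>Continuum many shifts\<close>

theorem theorem1p5:
  fixes \<alpha> :: real and f :: "nat \<Rightarrow> real"
  assumes "\<alpha> \<notin> \<rat>"
    and "mono_on {1..} f"
    and "\<And>N. N \<ge> 1 \<Longrightarrow> f N > 0"
    and "f \<in> o[at_top](\<lambda>N. real N)"
  shows "{\<gamma> :: real.
            (\<forall>n::nat. n \<ge> 1 \<longrightarrow> dist_nearest_int (real n * \<alpha> - \<gamma>) > 0) \<and>
            limsup (\<lambda>N. ereal (inverse (f N) *
              (recip_sum N \<alpha> \<gamma> -
               Max ((\<lambda>n. 1 / (real n * dist_nearest_int (real n * \<alpha> - \<gamma>))) ` {1..N})))) = \<infinity>}
         \<approx> (UNIV :: real set)" (is "?S \<approx> _")
proof -
  define avoid where "avoid n = {\<gamma>. 0 < dist_nearest_int (real n * \<alpha> - \<gamma>)}" for n :: nat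
  define \<U> where "\<U> = range avoid \<union> range (two_large_terms \<alpha> f)"
  have open_avoid: "open (avoid n)" for n
    unfolding avoid_def by (intro open_Collect_less continuous_intros)
  have dense_avoid: "closure (avoid n) = UNIV" for n
  proof -
    have "\<gamma> \<in> (\<lambda>p. real n * \<alpha> - p) ` \<int>" if "\<gamma> \<notin> avoid n" for \<gamma>
      using that by (intro image_eqI[of _ _ "real n * \<alpha> - \<gamma>"]) (auto simp: avoid_def dist_nearest_int_pos_iff)
    then have "- avoid n \<subseteq> (\<lambda>p. real n * \<alpha> - p) ` \<int>"
      by blast
    then have "countable (- avoid n)"
      by (rule countable_subset) (simp add: Ints_def)
    then have "interior (- avoid n) = {}"
      by (metis ball_minus_countable_nonempty Diff_eq_empty_iff equals0I mem_interior)
    then show ?thesis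
      by (auto simp: interior_complement)
  qed
  have "(UNIV :: real set) \<lesssim> \<Inter>\<U>"
    using open_avoid dense_avoid open_two_large_terms dense_two_large_terms[OF assms(1,4)]
    by (intro continuum_lepoll_dense_Inter) (auto simp: \<U>_def)
  moreover have "\<Inter>\<U> \<subseteq> ?S"
  proof
    fix \<gamma> assume \<gamma>: "\<gamma> \<in> \<Inter>\<U>"
    let ?t = "\<lambda>n. 1 / (real n * dist_nearest_int (real n * \<alpha> - \<gamma>))"
    have pos: "dist_nearest_int (real n * \<alpha> - \<gamma>) > 0" for n :: nat
      using \<gamma> by (auto simp: \<U>_def avoid_def)
    have "\<exists>N\<ge>K. real K \<le> inverse (f N) * (recip_sum N \<alpha> \<gamma> - Max (?t ` {1..N}))" for K
    proof -
      have "\<gamma> \<in> two_large_terms \<alpha> f K"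
        using \<gamma> by (auto simp: \<U>_def)
      then obtain N m n where N: "N \<ge> K" and mn: "m \<in> {1..N}" "n \<in> {1..N}" "m \<noteq> n"
        and small: "real m * dist_nearest_int (real m * \<alpha> - \<gamma>) * (real K * f N) < 1"
          "real n * dist_nearest_int (real n * \<alpha> - \<gamma>) * (real K * f N) < 1"
        unfolding two_large_terms_def by blast
      have large: "real K * f N \<le> ?t i"
        if "i \<in> {1..N}" "real i * dist_nearest_int (real i * \<alpha> - \<gamma>) * (real K * f N) < 1" for i
        using that pos[of i] by (subst pos_le_divide_eq) (auto simp: mult_ac)
      have "real K * f N \<le> sum ?t {1..N} - Max (?t ` {1..N})"
        by (rule le_sum_minus_Max[OF _ _ mn]) (use pos large mn small in \<open>auto simp: less_imp_le\<close>)
      moreover have "f N > 0"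
        using mn assms(3) by auto
      ultimately have "real K \<le> inverse (f N) * (recip_sum N \<alpha> \<gamma> - Max (?t ` {1..N}))"
        by (simp add: recip_sum_def field_simps)
      with N show ?thesis
        by blast
    qed
    then show "\<gamma> \<in> ?S"
      using pos limsup_eq_PInfty by simp
  qed
  ultimately have "(UNIV :: real set) \<lesssim> ?S"
    by (meson lepoll_trans subset_imp_lepoll)
  then show ?thesis
    by (meson lepoll_antisym subset_UNIV subset_imp_lepoll)
qed

end
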